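(* Let $M$ be a spacetime. The interval topology $T_{in}^{\rightarrow}$ on $M$ which is induced by the irreflexive horismos $\rightarrow$ has basic open sets which can be described as follows: for an event $x\in M$, a basic open set $A(x)$ is obtained by subtracting the null cone $C^L(x)$ of $x$ and replacing $x$ back, i.e. $A(x)=(M\setminus C^L(x))\cup\{x\}$.
   Context: $M$ denotes a spacetime; in the Minkowski case $M=\mathbb{R}^4$ with quadratic form $Q(x)=x_0^2-x_1^2-x_2^2-x_3^2$, where $x=(x_0,x_1,x_2,x_3)$. The null cone (light cone) of $x$ is $C^L(x)=\{y: Q(y-x)=0\}$ (in general, the union of the future and past null cones of $x$). Irreflexive horismos: $x\rightarrow y$ if $y\neq x$ and $y$ lies on the future null cone of $x$ (in Minkowski space: $Q(y-x)=0$ and $y_0>x_0$). Put $\mathcal{N}^+(x)=\{y\in M: x\rightarrow y\}$ and $\mathcal{N}^-(x)=\{y\in M: y\rightarrow x\}$. Interval topology $T_{in}^{\rightarrow}$: the future topology is generated by the subbase $\{M\setminus \mathcal{N}^-(x): x\in M\}$ and the past topology by the subbase $\{M\setminus\mathcal{N}^+(x): x\in M\}$; the interval topology $T_{in}^{\rightarrow}$ consists of basic sets which are finite intersections of subbasic sets of the past and the future topologies. *)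

theory Defs
  imports "HOL-Analysis.Analysis"
begin

section \<open>Spacetimes\<close>

text \<open>
  The coordinates of \<open>real ^ 4\<close> are numbered \<open>0, 1, 2, 3\<close>, with \<open>0\<close> the time coordinate
  (in the index type \<open>4\<close> the numeral \<open>4\<close> denotes \<open>0\<close>).
\<close>

definition minkowski_Q :: "real ^ 4 \<Rightarrow> real" where
  "minkowski_Q v = (v $ 0)\<^sup>2 - (v $ 1)\<^sup>2 - (v $ 2)\<^sup>2 - (v $ 3)\<^sup>2"

definition minkowski_form :: "real ^ 4 \<Rightarrow> real ^ 4 \<Rightarrow> real" where
  "minkowski_form u v = u $ 0 * v $ 0 - u $ 1 * v $ 1 - u $ 2 * v $ 2 - u $ 3 * v $ 3"

text \<open>Bilinear forms of signature \<open>(+,-,-,-)\<close>, as forms that have the standard shape in some basis.\<close>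

definition lorentzian_form :: "(real ^ 4 \<Rightarrow> real ^ 4 \<Rightarrow> real) \<Rightarrow> bool" where
  "lorentzian_form B \<longleftrightarrow>
    (\<exists>L. linear L \<and> bij L \<and> (\<forall>u v. B u v = minkowski_form (L u) (L v)))"

text \<open>On an open set \<open>S\<close>, \<open>Ck_on k f S\<close> says that \<open>f\<close> is of class \<open>C\<^sup>k\<close>.\<close>

primrec Ck_on :: "nat \<Rightarrow> ('b::euclidean_space \<Rightarrow> 'c::real_normed_vector) \<Rightarrow> 'b set \<Rightarrow> bool" where
  "Ck_on 0 f S \<longleftrightarrow> continuous_on S f"
| "Ck_on (Suc k) f S \<longleftrightarrow>
    (\<forall>x\<in>S. f differentiable (at x)) \<and> (\<forall>v. Ck_on k (\<lambda>x. frechet_derivative f (at x) v) S)"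

definition smooth_map_on :: "('b::euclidean_space \<Rightarrow> 'c::real_normed_vector) \<Rightarrow> 'b set \<Rightarrow> bool" where
  "smooth_map_on f S \<longleftrightarrow> (\<forall>k. Ck_on k f S)"

type_synonym 'a chart = "'a set \<times> ('a \<Rightarrow> real ^ 4)"

abbreviation dom_of :: "'a chart \<Rightarrow> 'a set" where "dom_of c \<equiv> fst c"
abbreviation coord :: "'a chart \<Rightarrow> 'a \<Rightarrow> real ^ 4" where "coord c \<equiv> snd c"

text \<open>
  Tensor fields are given by their components: \<open>metric M c p\<close> is the metric at \<open>p\<close> in the
  coordinates of the chart \<open>c\<close>, and \<open>time_field M c p\<close> is the vector at \<open>p\<close>, in the
  coordinates of \<open>c\<close>, of the field that gives the time orientation. Both are meaningful only for
  charts \<open>c\<close> of the atlas and points \<open>p\<close> in the domain of \<open>c\<close>.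
\<close>

record 'a spacetime_data =
  manifold :: "'a topology"
  atlas :: "'a chart set"
  metric :: "'a chart \<Rightarrow> 'a \<Rightarrow> real ^ 4 \<Rightarrow> real ^ 4 \<Rightarrow> real"
  time_field :: "'a chart \<Rightarrow> 'a \<Rightarrow> real ^ 4"

definition points :: "'a spacetime_data \<Rightarrow> 'a set" where
  "points M = topspace (manifold M)"

definition second_countable_space :: "'a topology \<Rightarrow> bool" where
  "second_countable_space X \<longleftrightarrow>
    (\<exists>\<B>. countable \<B> \<and> openin X = arbitrary union_of (\<lambda>U. U \<in> \<B>))"

definition chart_of :: "'a topology \<Rightarrow> 'a chart \<Rightarrow> bool" where
  "chart_of X c \<longleftrightarrow> openin X (dom_of c) \<and> open (coord c ` dom_of c) \<and>
    homeomorphic_map (subtopology X (dom_of c)) (top_of_set (coord c ` dom_of c)) (coord c)"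

definition chart_inv :: "'a chart \<Rightarrow> real ^ 4 \<Rightarrow> 'a" where
  "chart_inv c = inv_into (dom_of c) (coord c)"

definition transition :: "'a chart \<Rightarrow> 'a chart \<Rightarrow> real ^ 4 \<Rightarrow> real ^ 4" where
  "transition c d = coord d \<circ> chart_inv c"

definition jacobian :: "'a chart \<Rightarrow> 'a chart \<Rightarrow> 'a \<Rightarrow> real ^ 4 \<Rightarrow> real ^ 4" where
  "jacobian c d p = frechet_derivative (transition c d) (at (coord c p))"

definition smooth_atlas :: "'a topology \<Rightarrow> 'a chart set \<Rightarrow> bool" where
  "smooth_atlas X A \<longleftrightarrow>
    (\<forall>c\<in>A. chart_of X c) \<and>
    (\<Union>c\<in>A. dom_of c) = topspace X \<and>
    (\<forall>c\<in>A. \<forall>d\<in>A. smooth_map_on (transition c d) (coord c ` (dom_of c \<inter> dom_of d)))"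

definition lorentzian_metric ::
  "'a chart set \<Rightarrow> ('a chart \<Rightarrow> 'a \<Rightarrow> real ^ 4 \<Rightarrow> real ^ 4 \<Rightarrow> real) \<Rightarrow> bool" where
  "lorentzian_metric A g \<longleftrightarrow>
    (\<forall>c\<in>A. \<forall>p\<in>dom_of c. lorentzian_form (g c p)) \<and>
    (\<forall>c\<in>A. \<forall>u v. smooth_map_on (\<lambda>z. g c (chart_inv c z) u v) (coord c ` dom_of c)) \<and>
    (\<forall>c\<in>A. \<forall>d\<in>A. \<forall>p\<in>dom_of c \<inter> dom_of d. \<forall>u v.
        g c p u v = g d p (jacobian c d p u) (jacobian c d p v))"

text \<open>A time orientation is given by a continuous, nowhere vanishing timelike vector field.\<close>

definition time_orienting ::
  "'a topology \<Rightarrow> 'a chart set \<Rightarrow> ('a chart \<Rightarrow> 'a \<Rightarrow> real ^ 4 \<Rightarrow> real ^ 4 \<Rightarrow> real)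
    \<Rightarrow> ('a chart \<Rightarrow> 'a \<Rightarrow> real ^ 4) \<Rightarrow> bool" where
  "time_orienting X A g \<tau> \<longleftrightarrow>
    (\<forall>c\<in>A. continuous_map (subtopology X (dom_of c)) euclidean (\<tau> c)) \<and>
    (\<forall>c\<in>A. \<forall>p\<in>dom_of c. g c p (\<tau> c p) (\<tau> c p) > 0) \<and>
    (\<forall>c\<in>A. \<forall>d\<in>A. \<forall>p\<in>dom_of c \<inter> dom_of d. \<tau> d p = jacobian c d p (\<tau> c p))"

definition spacetime :: "'a spacetime_data \<Rightarrow> bool" where
  "spacetime M \<longleftrightarrow>
    Hausdorff_space (manifold M) \<and> second_countable_space (manifold M) \<and>
    connected_space (manifold M) \<and>
    smooth_atlas (manifold M) (atlas M) \<and>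
    lorentzian_metric (atlas M) (metric M) \<and>
    time_orienting (manifold M) (atlas M) (metric M) (time_field M)"


section \<open>Causal relations\<close>

definition future_timelike :: "'a spacetime_data \<Rightarrow> 'a chart \<Rightarrow> 'a \<Rightarrow> real ^ 4 \<Rightarrow> bool" where
  "future_timelike M c p v \<longleftrightarrow> metric M c p v v > 0 \<and> metric M c p v (time_field M c p) > 0"

text \<open>The second condition also excludes \<open>v = 0\<close>.\<close>

definition future_causal :: "'a spacetime_data \<Rightarrow> 'a chart \<Rightarrow> 'a \<Rightarrow> real ^ 4 \<Rightarrow> bool" where
  "future_causal M c p v \<longleftrightarrow> metric M c p v v \<ge> 0 \<and> metric M c p v (time_field M c p) > 0"

text \<open>
  A \<open>C\<^sup>1\<close> curve on \<open>[0,1]\<close> all of whose velocities, the one-sided ones at the end points included,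
  satisfy \<open>P\<close>.
\<close>

definition C1_segment ::
  "'a spacetime_data \<Rightarrow> ('a chart \<Rightarrow> 'a \<Rightarrow> real ^ 4 \<Rightarrow> bool) \<Rightarrow> (real \<Rightarrow> 'a) \<Rightarrow> bool" where
  "C1_segment M P \<gamma> \<longleftrightarrow>
    continuous_map (top_of_set {0..1}) (manifold M) \<gamma> \<and>
    (\<forall>c\<in>atlas M. \<exists>v. continuous_on {t \<in> {0..1}. \<gamma> t \<in> dom_of c} v \<and>
      (\<forall>t\<in>{0..1}. \<gamma> t \<in> dom_of c \<longrightarrow>
        ((coord c \<circ> \<gamma>) has_vector_derivative v t) (at t within {0..1}) \<and> P c (\<gamma> t) (v t)))"

definition joined_by :: "'a spacetime_data \<Rightarrow> ('a chart \<Rightarrow> 'a \<Rightarrow> real ^ 4 \<Rightarrow> bool)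
    \<Rightarrow> 'a \<Rightarrow> 'a \<Rightarrow> bool" where
  "joined_by M P x y \<longleftrightarrow> (\<exists>\<gamma>. C1_segment M P \<gamma> \<and> \<gamma> 0 = x \<and> \<gamma> 1 = y)"

text \<open>
  Piecewise \<open>C\<^sup>1\<close> curves are finite concatenations of \<open>C\<^sup>1\<close> segments; they enter through the
  transitive closures. As usual every event causally precedes itself, but it precedes itself
  chronologically only if there is a closed timelike curve through it.
\<close>

definition chronological :: "'a spacetime_data \<Rightarrow> 'a \<Rightarrow> 'a \<Rightarrow> bool" where
  "chronological M = tranclp (joined_by M (future_timelike M))"

definition causal :: "'a spacetime_data \<Rightarrow> 'a \<Rightarrow> 'a \<Rightarrow> bool" where
  "causal M = rtranclp (joined_by M (future_causal M))"

definition future_null_cone :: "'a spacetime_data \<Rightarrow> 'a \<Rightarrow> 'a set" where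
  "future_null_cone M x = {y \<in> points M. causal M x y \<and> \<not> chronological M x y}"

definition past_null_cone :: "'a spacetime_data \<Rightarrow> 'a \<Rightarrow> 'a set" where
  "past_null_cone M x = {y \<in> points M. causal M y x \<and> \<not> chronological M y x}"

definition null_cone :: "'a spacetime_data \<Rightarrow> 'a \<Rightarrow> 'a set" where
  "null_cone M x = future_null_cone M x \<union> past_null_cone M x"

definition irreflexive_horismos :: "'a spacetime_data \<Rightarrow> 'a \<Rightarrow> 'a \<Rightarrow> bool" where
  "irreflexive_horismos M x y \<longleftrightarrow> y \<noteq> x \<and> y \<in> future_null_cone M x"


section \<open>The interval topology of a relation\<close>

definition N_plus :: "'a set \<Rightarrow> ('a \<Rightarrow> 'a \<Rightarrow> bool) \<Rightarrow> 'a \<Rightarrow> 'a set" where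
  "N_plus X r x = {y \<in> X. r x y}"

definition N_minus :: "'a set \<Rightarrow> ('a \<Rightarrow> 'a \<Rightarrow> bool) \<Rightarrow> 'a \<Rightarrow> 'a set" where
  "N_minus X r x = {y \<in> X. r y x}"

definition future_subbase :: "'a set \<Rightarrow> ('a \<Rightarrow> 'a \<Rightarrow> bool) \<Rightarrow> 'a set set" where
  "future_subbase X r = {X - N_minus X r x | x. x \<in> X}"

definition past_subbase :: "'a set \<Rightarrow> ('a \<Rightarrow> 'a \<Rightarrow> bool) \<Rightarrow> 'a set set" where
  "past_subbase X r = {X - N_plus X r x | x. x \<in> X}"

text \<open>\<open>relative_to X\<close> makes the empty intersection equal to \<open>X\<close>.\<close>

definition interval_basic :: "'a set \<Rightarrow> ('a \<Rightarrow> 'a \<Rightarrow> bool) \<Rightarrow> 'a set \<Rightarrow> bool" where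
  "interval_basic X r =
    (finite intersection_of (\<lambda>U. U \<in> future_subbase X r \<union> past_subbase X r) relative_to X)"

definition interval_topology :: "'a set \<Rightarrow> ('a \<Rightarrow> 'a \<Rightarrow> bool) \<Rightarrow> 'a topology" where
  "interval_topology X r = topology (arbitrary union_of interval_basic X r)"

lemma openin_interval_topology:
  "openin (interval_topology X r) = arbitrary union_of interval_basic X r"
  unfolding interval_topology_def interval_basic_def
  by (rule ext) (rule openin_subbase)

lemma topspace_interval_topology: "topspace (interval_topology X r) = X"
  unfolding interval_topology_def interval_basic_def by (rule topspace_subbase)


section \<open>Minkowski space\<close>

definition minkowski_spacetime :: "(real ^ 4) spacetime_data" where
  "minkowski_spacetime =
    \<lparr> manifold = euclidean, atlas = {(UNIV, id)},
      metric = (\<lambda>c p. minkowski_form), time_field = (\<lambda>c p. axis 0 1) \<rparr>"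

lemma real4_eqI:
  fixes x y :: "real ^ 4"
  assumes "x $ 0 = y $ 0" "x $ 1 = y $ 1" "x $ 2 = y $ 2" "x $ 3 = y $ 3"
  shows "x = y"
proof -
  have four: "(4 :: 4) = 0" by simp
  have "\<forall>i. x $ i = y $ i"
    unfolding forall_4 four using assms by blast
  then show ?thesis by (subst vec_eq_iff)
qed

lemma Ck_on_const: "Ck_on k (\<lambda>x. b) S"
  by (induction k arbitrary: b) (auto simp: frechet_derivative_const)

lemma smooth_map_on_const: "smooth_map_on (\<lambda>x. b) S"
  by (simp add: smooth_map_on_def Ck_on_const)

lemma smooth_map_on_id: "smooth_map_on id S"
  unfolding smooth_map_on_def
proof
  fix k show "Ck_on k (id :: 'a \<Rightarrow> 'a) S"
    by (cases k) (auto simp: id_def frechet_derivative_ident Ck_on_const continuous_on_id)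
qed

lemma minkowski_transition [simp]: "transition (UNIV, id) (UNIV, id) = id"
  by (simp add: transition_def chart_inv_def fun_eq_iff)

lemma minkowski_jacobian [simp]: "jacobian (UNIV, id) (UNIV, id) p v = v"
  unfolding jacobian_def minkowski_transition by (simp add: id_def frechet_derivative_ident)

lemma minkowski_time_axis [simp]:
  "minkowski_form v (axis 0 1) = v $ 0"
  by (simp add: minkowski_form_def axis_def)

lemma minkowski_form_self: "minkowski_form v v = minkowski_Q v"
  by (simp add: minkowski_form_def minkowski_Q_def power2_eq_square)

lemma spacetime_minkowski: "spacetime minkowski_spacetime"
proof -
  have "second_countable_space (euclidean :: (real^4) topology)"
  proof -
    obtain B :: "(real^4) set set" where B: "countable B" "\<And>C. C \<in> B \<Longrightarrow> open C"
      "\<And>S. open S \<Longrightarrow> \<exists>U. U \<subseteq> B \<and> S = \<Union>U"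
      by (metis univ_second_countable)
    have "openin (euclidean :: (real^4) topology) = arbitrary union_of (\<lambda>U. U \<in> B)"
    proof (rule ext, rule iffI)
      fix S :: "(real^4) set"
      assume "openin euclidean S"
      then obtain U where "U \<subseteq> B" "S = \<Union>U" using B(3) by auto
      then show "(arbitrary union_of (\<lambda>U. U \<in> B)) S"
        by (auto simp: union_of_def arbitrary_def)
    next
      fix S :: "(real^4) set"
      assume "(arbitrary union_of (\<lambda>U. U \<in> B)) S"
      then show "openin euclidean S"
        using B(2) by (auto simp: union_of_def arbitrary_def)
    qed
    then show ?thesis using B(1) unfolding second_countable_space_def by blast
  qed
  moreover have "connected_space (euclidean :: (real^4) topology)"
    using connectedin_def connectedin_iff_connected connected_UNIV
    by (metis connectedin_topspace topspace_euclidean)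
  moreover have "lorentzian_form minkowski_form"
    unfolding lorentzian_form_def by (intro exI[of _ id]) (auto simp: linear_id)
  moreover have "smooth_atlas (euclidean :: (real^4) topology) {(UNIV, id)}"
    by (auto simp: smooth_atlas_def chart_of_def smooth_map_on_id)
  ultimately show ?thesis
    by (auto simp: spacetime_def minkowski_spacetime_def lorentzian_metric_def
        smooth_map_on_const time_orienting_def)
qed

lemma minkowski_spacetime_simps [simp]:
  "points minkowski_spacetime = UNIV"
  "future_causal minkowski_spacetime c p v \<longleftrightarrow> minkowski_Q v \<ge> 0 \<and> v $ 0 > 0"
  "future_timelike minkowski_spacetime c p v \<longleftrightarrow> minkowski_Q v > 0 \<and> v $ 0 > 0"
  by (auto simp: points_def minkowski_spacetime_def future_causal_def future_timelike_def
      minkowski_form_self)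

lemma minkowski_C1_segment:
  "C1_segment minkowski_spacetime P \<gamma> \<longleftrightarrow> continuous_on {0..1} \<gamma> \<and>
    (\<exists>v. continuous_on {0..1} v \<and> (\<forall>t\<in>{0..1}.
        (\<gamma> has_vector_derivative v t) (at t within {0..1}) \<and> P (UNIV, id) (\<gamma> t) (v t)))"
  by (simp add: C1_segment_def minkowski_spacetime_def atLeastAtMost_def atLeast_def atMost_def
      Collect_conj_eq)

lemma minkowski_joined_by_line:
  assumes "\<And>p. P (UNIV, id) p (y - x)"
  shows "joined_by minkowski_spacetime P x y"
proof -
  have "C1_segment minkowski_spacetime P (\<lambda>t. x + t *\<^sub>R (y - x))"
    unfolding minkowski_C1_segment
    using assms
    by (auto intro!: continuous_intros exI[of _ "\<lambda>_. y - x"] derivative_eq_intros)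
  then show ?thesis
    unfolding joined_by_def by (intro exI[of _ "\<lambda>t. x + t *\<^sub>R (y - x)"]) auto
qed

definition cone_functional :: "real \<Rightarrow> real \<Rightarrow> real \<Rightarrow> real ^ 4 \<Rightarrow> real" where
  "cone_functional a b c w = w $ 0 - (a * w $ 1 + b * w $ 2 + c * w $ 3)"

lemma cone_functional_bounded_linear: "bounded_linear (cone_functional a b c)"
  unfolding cone_functional_def
  by (intro bounded_linear_sub bounded_linear_add bounded_linear_const_mult bounded_linear_vec_nth)

lemma spatial_cauchy_schwarz:
  fixes a b c u v w :: real
  assumes "a\<^sup>2 + b\<^sup>2 + c\<^sup>2 \<le> 1"
  shows "(a * u + b * v + c * w)\<^sup>2 \<le> u\<^sup>2 + v\<^sup>2 + w\<^sup>2"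
proof -
  have "(a * u + b * v + c * w)\<^sup>2 \<le> (a\<^sup>2 + b\<^sup>2 + c\<^sup>2) * (u\<^sup>2 + v\<^sup>2 + w\<^sup>2)"
  proof -
    have "(a\<^sup>2 + b\<^sup>2 + c\<^sup>2) * (u\<^sup>2 + v\<^sup>2 + w\<^sup>2) - (a * u + b * v + c * w)\<^sup>2
        = (a * v - b * u)\<^sup>2 + (a * w - c * u)\<^sup>2 + (b * w - c * v)\<^sup>2"
      by (simp add: power2_eq_square algebra_simps)
    also have "\<dots> \<ge> 0" by simp
    finally show ?thesis by simp
  qed
  also have "\<dots> \<le> 1 * (u\<^sup>2 + v\<^sup>2 + w\<^sup>2)"
    using assms by (intro mult_right_mono) auto
  finally show ?thesis by simp
qed

lemma causal_cone_iff:
  "w $ 0 \<ge> 0 \<and> minkowski_Q w \<ge> 0 \<longleftrightarrow>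
    (\<forall>a b c. a\<^sup>2 + b\<^sup>2 + c\<^sup>2 \<le> 1 \<longrightarrow> cone_functional a b c w \<ge> 0)" (is "?L \<longleftrightarrow> ?R")
  and timelike_cone_iff:
  "w $ 0 > 0 \<and> minkowski_Q w > 0 \<longleftrightarrow>
    (\<forall>a b c. a\<^sup>2 + b\<^sup>2 + c\<^sup>2 \<le> 1 \<longrightarrow> cone_functional a b c w > 0)" (is "?L' \<longleftrightarrow> ?R'")
proof -
  define r where "r = sqrt ((w $ 1)\<^sup>2 + (w $ 2)\<^sup>2 + (w $ 3)\<^sup>2)"
  have r: "r \<ge> 0" "r\<^sup>2 = (w $ 1)\<^sup>2 + (w $ 2)\<^sup>2 + (w $ 3)\<^sup>2"
    by (simp_all add: r_def)
  have Q: "minkowski_Q w = (w $ 0)\<^sup>2 - r\<^sup>2"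
    by (simp add: minkowski_Q_def r)
  have L: "?L \<longleftrightarrow> r \<le> w $ 0"
    unfolding Q using r(1) abs_le_square_iff[of r "w $ 0"] by auto
  have L': "?L' \<longleftrightarrow> r < w $ 0"
    unfolding Q using r(1) abs_le_square_iff[of "w $ 0" r] by (auto simp: not_le[symmetric])
  have le: "a * w $ 1 + b * w $ 2 + c * w $ 3 \<le> r" if "a\<^sup>2 + b\<^sup>2 + c\<^sup>2 \<le> 1" for a b c
    using spatial_cauchy_schwarz[OF that, of "w $ 1" "w $ 2" "w $ 3"] r
    by (metis power2_le_imp_le)
  obtain a b c where abc: "a\<^sup>2 + b\<^sup>2 + c\<^sup>2 \<le> 1" "a * w $ 1 + b * w $ 2 + c * w $ 3 = r"
  proof (cases "r = 0")
    case True
    then show ?thesis using that[of 0 0 0] by simp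
  next
    case False
    have "(w $ 1 / r)\<^sup>2 + (w $ 2 / r)\<^sup>2 + (w $ 3 / r)\<^sup>2 = r\<^sup>2 / r\<^sup>2"
      by (simp only: power_divide r add_divide_distrib)
    moreover have "w $ 1 / r * w $ 1 + w $ 2 / r * w $ 2 + w $ 3 / r * w $ 3 = r\<^sup>2 / r"
      unfolding r(2) by (simp add: add_divide_distrib power2_eq_square)
    moreover have "r\<^sup>2 / r = r" by (simp add: power2_eq_square)
    ultimately show ?thesis using False by (intro that[of "w $ 1 / r" "w $ 2 / r" "w $ 3 / r"]) auto
  qed
  show "?L \<longleftrightarrow> ?R"
    unfolding L cone_functional_def
  proof
    assume "r \<le> w $ 0"
    then show "\<forall>a b c. a\<^sup>2 + b\<^sup>2 + c\<^sup>2 \<le> 1 \<longrightarrow> 0 \<le> w $ 0 - (a * w $ 1 + b * w $ 2 + c * w $ 3)"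
      by (auto dest!: le)
  next
    assume "\<forall>a b c. a\<^sup>2 + b\<^sup>2 + c\<^sup>2 \<le> 1 \<longrightarrow> 0 \<le> w $ 0 - (a * w $ 1 + b * w $ 2 + c * w $ 3)"
    from this[rule_format, OF abc(1)] show "r \<le> w $ 0" by (simp add: abc(2))
  qed
  show "?L' \<longleftrightarrow> ?R'"
    unfolding L' cone_functional_def
  proof
    assume "r < w $ 0"
    then show "\<forall>a b c. a\<^sup>2 + b\<^sup>2 + c\<^sup>2 \<le> 1 \<longrightarrow> 0 < w $ 0 - (a * w $ 1 + b * w $ 2 + c * w $ 3)"
      by (auto dest!: le)
  next
    assume "\<forall>a b c. a\<^sup>2 + b\<^sup>2 + c\<^sup>2 \<le> 1 \<longrightarrow> 0 < w $ 0 - (a * w $ 1 + b * w $ 2 + c * w $ 3)"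
    from this[rule_format, OF abc(1)] show "r < w $ 0" by (simp add: abc(2))
  qed
qed

lemma minkowski_segment_mvt:
  assumes "joined_by minkowski_spacetime P x y"
  obtains p v where "P (UNIV, id) p v" "cone_functional a b c (y - x) = cone_functional a b c v"
proof -
  obtain \<gamma> v where v: "\<And>t. t \<in> {0..1} \<Longrightarrow> (\<gamma> has_vector_derivative v t) (at t within {0..1})"
      "\<And>t. t \<in> {0..1} \<Longrightarrow> P (UNIV, id) (\<gamma> t) (v t)" and ends: "\<gamma> 0 = x" "\<gamma> 1 = y"
    using assms unfolding joined_by_def minkowski_C1_segment by blast
  let ?f = "cone_functional a b c"
  interpret bounded_linear ?f by (rule cone_functional_bounded_linear)
  have "((\<lambda>t. ?f (\<gamma> t)) has_derivative (\<lambda>h. ?f (h *\<^sub>R v t))) (at t within {0..1})"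
    if "0 \<le> t" "t \<le> 1" for t
    using v(1)[of t] that unfolding has_vector_derivative_def by (auto intro: has_derivative)
  then obtain t where "t \<in> {0<..<1}" "?f (\<gamma> 1) - ?f (\<gamma> 0) = ?f ((1 - 0) *\<^sub>R v t)"
    using mvt_simple[of 0 1 "\<lambda>t. ?f (\<gamma> t)" "\<lambda>t h. ?f (h *\<^sub>R v t)"] by auto
  then show ?thesis
    using v(2)[of t] ends by (intro that[of "\<gamma> t" "v t"]) (auto simp: diff)
qed

lemma cone_functional_diff_add:
  "cone_functional a b c (z - x) = cone_functional a b c (y - x) + cone_functional a b c (z - y)"
  by (simp add: cone_functional_def algebra_simps)

theorem minkowski_causal_iff:
  "causal minkowski_spacetime x y \<longleftrightarrow> x $ 0 \<le> y $ 0 \<and> minkowski_Q (y - x) \<ge> 0"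
proof -
  have pos: "cone_functional a b c (y - x) \<ge> 0"
    if xy: "joined_by minkowski_spacetime (future_causal minkowski_spacetime) x y"
      and abc: "a\<^sup>2 + b\<^sup>2 + c\<^sup>2 \<le> 1" for x y a b c
  proof -
    obtain p v where v: "future_causal minkowski_spacetime (UNIV, id) p v"
      "cone_functional a b c (y - x) = cone_functional a b c v"
      using minkowski_segment_mvt[OF xy] by metis
    then show ?thesis using causal_cone_iff[of v] abc by auto
  qed
  have "cone_functional a b c (y - x) \<ge> 0"
    if "causal minkowski_spacetime x y" and abc: "a\<^sup>2 + b\<^sup>2 + c\<^sup>2 \<le> 1" for a b c
    using that(1) unfolding causal_def
  proof (induction rule: rtranclp_induct)
    case base
    then show ?case by (simp add: cone_functional_def)
  next
    case (step y z)
    then show ?case using pos[OF step(2) abc] cone_functional_diff_add[of a b c z x y] by simp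
  qed
  then have 1: "(y - x) $ 0 \<ge> 0 \<and> minkowski_Q (y - x) \<ge> 0" if "causal minkowski_spacetime x y"
    unfolding causal_cone_iff using that by blast
  have 2: "causal minkowski_spacetime x y" if *: "x $ 0 \<le> y $ 0" "minkowski_Q (y - x) \<ge> 0"
  proof (cases "x $ 0 = y $ 0")
    case True
    with * have "(y $ 1 - x $ 1)\<^sup>2 + (y $ 2 - x $ 2)\<^sup>2 + (y $ 3 - x $ 3)\<^sup>2 \<le> 0"
      by (simp add: minkowski_Q_def)
    then have "y $ 1 = x $ 1 \<and> y $ 2 = x $ 2 \<and> y $ 3 = x $ 3"
      by (smt (verit) zero_le_power2 zero_eq_power2)
    with True have "x = y" by (intro real4_eqI) auto
    then show ?thesis by (simp add: causal_def)
  next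
    case False
    with * show ?thesis
      unfolding causal_def by (intro r_into_rtranclp minkowski_joined_by_line) auto
  qed
  from 1 2 show ?thesis by auto
qed

theorem minkowski_chronological_iff:
  "chronological minkowski_spacetime x y \<longleftrightarrow> x $ 0 < y $ 0 \<and> minkowski_Q (y - x) > 0"
proof -
  have pos: "cone_functional a b c (y - x) > 0"
    if xy: "joined_by minkowski_spacetime (future_timelike minkowski_spacetime) x y"
      and abc: "a\<^sup>2 + b\<^sup>2 + c\<^sup>2 \<le> 1" for x y a b c
  proof -
    obtain p v where v: "future_timelike minkowski_spacetime (UNIV, id) p v"
      "cone_functional a b c (y - x) = cone_functional a b c v"
      using minkowski_segment_mvt[OF xy] by metis
    then show ?thesis using timelike_cone_iff[of v] abc by auto
  qed
  have "cone_functional a b c (y - x) > 0"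
    if "chronological minkowski_spacetime x y" and abc: "a\<^sup>2 + b\<^sup>2 + c\<^sup>2 \<le> 1" for a b c
    using that(1) unfolding chronological_def
  proof (induction rule: tranclp_induct)
    case (base y)
    then show ?case using pos abc by blast
  next
    case (step y z)
    then show ?case using pos[OF step(2) abc] cone_functional_diff_add[of a b c z x y] by simp
  qed
  then have 1: "(y - x) $ 0 > 0 \<and> minkowski_Q (y - x) > 0" if "chronological minkowski_spacetime x y"
    unfolding timelike_cone_iff using that by blast
  have 2: "chronological minkowski_spacetime x y" if "x $ 0 < y $ 0" "minkowski_Q (y - x) > 0"
    using that unfolding chronological_def
    by (intro tranclp.r_into_trancl minkowski_joined_by_line) auto
  from 1 2 show ?thesis by auto
qed

theorem minkowski_future_null_cone:
  "future_null_cone minkowski_spacetime x = {y. minkowski_Q (y - x) = 0 \<and> x $ 0 \<le> y $ 0}"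
proof -
  have "minkowski_Q (y - x) \<le> 0" if "x $ 0 = y $ 0" for y
    using that by (simp add: minkowski_Q_def) (smt (verit) zero_le_power2)
  then show ?thesis
    by (force simp: future_null_cone_def minkowski_causal_iff minkowski_chronological_iff)
qed

lemma minkowski_Q_minus_commute: "minkowski_Q (x - y) = minkowski_Q (y - x)"
  by (simp add: minkowski_Q_def power2_commute)

theorem minkowski_null_cone:
  "null_cone minkowski_spacetime x = {y. minkowski_Q (y - x) = 0}"
proof -
  have "past_null_cone minkowski_spacetime x = {y. x \<in> future_null_cone minkowski_spacetime y}"
    by (auto simp: past_null_cone_def future_null_cone_def)
  also have "\<dots> = {y. minkowski_Q (y - x) = 0 \<and> y $ 0 \<le> x $ 0}"
  proof (rule set_eqI)
    fix y
    show "y \<in> {y. x \<in> future_null_cone minkowski_spacetime y} \<longleftrightarrow>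
        y \<in> {y. minkowski_Q (y - x) = 0 \<and> y $ 0 \<le> x $ 0}"
      unfolding minkowski_future_null_cone mem_Collect_eq minkowski_Q_minus_commute[of x y] by (rule refl)
  qed
  finally have past: "past_null_cone minkowski_spacetime x =
    {y. minkowski_Q (y - x) = 0 \<and> y $ 0 \<le> x $ 0}" .
  show ?thesis
  proof (rule set_eqI)
    fix y
    show "y \<in> null_cone minkowski_spacetime x \<longleftrightarrow> y \<in> {y. minkowski_Q (y - x) = 0}"
      unfolding null_cone_def past minkowski_future_null_cone Un_iff mem_Collect_eq
      using linear[of "x $ 0" "y $ 0"] by blast
  qed
qed

theorem minkowski_irreflexive_horismos:
  "irreflexive_horismos minkowski_spacetime x y \<longleftrightarrow> minkowski_Q (y - x) = 0 \<and> x $ 0 < y $ 0"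
proof -
  have "y = x" if "minkowski_Q (y - x) = 0" "x $ 0 = y $ 0"
  proof -
    from that have "(y $ 1 - x $ 1)\<^sup>2 + (y $ 2 - x $ 2)\<^sup>2 + (y $ 3 - x $ 3)\<^sup>2 = 0"
      by (simp add: minkowski_Q_def)
    then have "y $ 1 = x $ 1 \<and> y $ 2 = x $ 2 \<and> y $ 3 = x $ 3"
      by (smt (verit) zero_le_power2 zero_eq_power2)
    with that(2) show ?thesis by (intro real4_eqI) auto
  qed
  then show ?thesis
    by (force simp: irreflexive_horismos_def minkowski_future_null_cone)
qed

end

theory Submission
  imports Defs
begin

text \<open>For the irreflexive horismos, \<open>N_minus\<close> and \<open>N_plus\<close> at
  \<open>x\<close> together make up the null cone of \<open>x\<close> with \<open>x\<close> itself
  removed. By De Morgan, the complement of the cone with \<open>x\<close> put back is the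
  intersection of two subbasic sets, one from each subbase, hence basic and open.\<close>

text \<open>The horismos refers to future cones only; this symmetry lets \<open>N_minus\<close> be
  read as the past cone of \<open>x\<close> without \<open>x\<close>.\<close>

lemma mem_past_null_cone_iff:
  "x \<in> points M \<Longrightarrow> y \<in> past_null_cone M x \<longleftrightarrow> y \<in> points M \<and> x \<in> future_null_cone M y"
  by (auto simp: past_null_cone_def future_null_cone_def)

lemma interval_basic_diff_N:
  assumes "x \<in> X"
  shows "interval_basic X r ((X - N_minus X r x) \<inter> (X - N_plus X r x))"
proof -
  let ?A = "X - N_minus X r x" and ?B = "X - N_plus X r x"
  let ?P = "\<lambda>U. U \<in> future_subbase X r \<union> past_subbase X r"
  have "?P ?A" "?P ?B"
    using assms by (auto simp: future_subbase_def past_subbase_def)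
  then have "(finite intersection_of ?P) (?A \<inter> ?B)"
    by (intro finite_intersection_of_Int finite_intersection_of_inc)
  \<comment> \<open>\<open>relative_to X\<close> asks for a set of the form
    \<open>X \<inter> S\<close>.\<close>
  moreover have "X \<inter> (?A \<inter> ?B) = ?A \<inter> ?B" by blast
  ultimately show ?thesis
    unfolding interval_basic_def relative_to_def by blast
qed

lemma openin_interval_basic: "interval_basic X r U \<Longrightarrow> openin (interval_topology X r) U"
  unfolding openin_interval_topology by (rule arbitrary_union_of_inc)

theorem proposition3p1:
  fixes M :: "'a spacetime_data" and x :: 'a
  assumes "spacetime M" and "x \<in> points M"
  shows "(points M - null_cone M x) \<union> {x} =
           (points M - N_minus (points M) (irreflexive_horismos M) x) \<inter>
           (points M - N_plus (points M) (irreflexive_horismos M) x) \<and>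
         interval_basic (points M) (irreflexive_horismos M)
           ((points M - null_cone M x) \<union> {x}) \<and>
         openin (interval_topology (points M) (irreflexive_horismos M))
           ((points M - null_cone M x) \<union> {x})"
proof -
  \<comment> \<open>Irreflexivity keeps \<open>x\<close> in both factors, whether or not
    \<open>x\<close> lies on its own null cone.\<close>
  have eq: "(points M - null_cone M x) \<union> {x} =
      (points M - N_minus (points M) (irreflexive_horismos M) x) \<inter>
      (points M - N_plus (points M) (irreflexive_horismos M) x)"
    using assms(2)
    by (auto simp: null_cone_def N_minus_def N_plus_def irreflexive_horismos_def
        mem_past_null_cone_iff)
  show ?thesis
    using eq interval_basic_diff_N[OF assms(2)] openin_interval_basic by metis
qed

end
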